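(* Let $G$ be an $n$-vertex graph with minimum cut value $c$, and suppose that each edge of $G$ fails independently with probability $p$, where $p^c=n^{-(2+\delta)}$ for some $\delta>0$. Then: (1) the probability that $G$ becomes disconnected is at most $n^{-\delta}(1+2/\delta)$; and (2) for every $\alpha\ge 1$, the probability that some cut of $G$ of value $\alpha c$ or greater fails is at most $n^{-\alpha\delta}(1+2/\delta)$.
   Context: Graphs are undirected; parallel edges are allowed. A cut is a partition of the vertex set into two nonempty groups; its edges are the edges with one endpoint in each group, and its value is the number of its edges. The minimum cut value $c$ is the smallest value of any cut. A cut fails if all of its edges fail (are deleted). The graph becomes disconnected if the surviving edges do not connect all the vertices. *)

theory Defs
  imports "HOL-Probability.Probability" "HOL-Library.Disjoint_Sets"
begin

text \<open>
  Edges are objects of their own, and \<open>ends\<close> maps an edge to its unordered set of endpoints;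
  so distinct edges may be parallel. Loops (edges with a single endpoint) are also permitted: they
  belong to no cut and do not influence connectivity.
\<close>

record ('v, 'e) multigraph =
  verts :: "'v set"
  edges :: "'e set"
  ends :: "'e \<Rightarrow> 'v set"

locale fin_multigraph =
  fixes G :: "('v, 'e) multigraph"
  assumes finite_verts: "finite (verts G)"
    and finite_edges: "finite (edges G)"
    and ends_in_verts: "e \<in> edges G \<Longrightarrow> ends G e \<subseteq> verts G"
    and card_ends: "e \<in> edges G \<Longrightarrow> card (ends G e) \<in> {1, 2}"

definition adjacency :: "('v, 'e) multigraph \<Rightarrow> ('v \<times> 'v) set" where
  "adjacency G = {(u, v). \<exists>e\<in>edges G. ends G e = {u, v}}"

definition graph_connected :: "('v, 'e) multigraph \<Rightarrow> bool" where
  "graph_connected G \<longleftrightarrow> (\<forall>u\<in>verts G. \<forall>v\<in>verts G. (u, v) \<in> (adjacency G)\<^sup>*)"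

definition delete_edges :: "('v, 'e) multigraph \<Rightarrow> 'e set \<Rightarrow> ('v, 'e) multigraph" where
  "delete_edges G D = G\<lparr>edges := edges G - D\<rparr>"

text \<open>
  A cut is the unordered pair of its two groups; \<^const>\<open>partition_on\<close> includes that the groups are
  nonempty. As an edge has at most two endpoints, meeting both groups means having exactly one
  endpoint in each.
\<close>

definition cuts :: "('v, 'e) multigraph \<Rightarrow> 'v set set set" where
  "cuts G = {C. partition_on (verts G) C \<and> card C = 2}"

definition cut_edges :: "('v, 'e) multigraph \<Rightarrow> 'v set set \<Rightarrow> 'e set" where
  "cut_edges G C = {e \<in> edges G. \<forall>S\<in>C. ends G e \<inter> S \<noteq> {}}"

definition cut_value :: "('v, 'e) multigraph \<Rightarrow> 'v set set \<Rightarrow> nat" where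
  "cut_value G C = card (cut_edges G C)"

text \<open>Meaningful only for at least two vertices; otherwise there is no cut.\<close>

definition min_cut_value :: "('v, 'e) multigraph \<Rightarrow> nat" where
  "min_cut_value G = Min (cut_value G ` cuts G)"

text \<open>
  \<open>F e\<close> is the event that edge \<open>e\<close> fails; \<open>failed_edges G F \<omega>\<close> is the set of edges that fail in the
  outcome \<open>\<omega>\<close>.
\<close>

definition failed_edges :: "('v, 'e) multigraph \<Rightarrow> ('e \<Rightarrow> 'w set) \<Rightarrow> 'w \<Rightarrow> 'e set" where
  "failed_edges G F \<omega> = {e \<in> edges G. \<omega> \<in> F e}"

definition cut_fails :: "('v, 'e) multigraph \<Rightarrow> 'e set \<Rightarrow> 'v set set \<Rightarrow> bool" where
  "cut_fails G D C \<longleftrightarrow> cut_edges G C \<subseteq> D"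

end

theory Submission
  imports Defs
begin

text \<open>
  By Karger's contraction argument, at most \<open>n powr (2 * t)\<close> cuts have value at most \<open>t * c\<close>, for
  every real \<open>t \<ge> 1\<close>: contracting an edge chosen uniformly from a graph on \<open>m\<close> vertices, which has at
  least \<open>m * c / 2\<close> edges by the handshake lemma, destroys such a cut with probability at most
  \<open>2 * t / m\<close>. The probability that some cut of value at least \<open>\<alpha> * c\<close> fails is at most the sum of
  \<open>p ^ v\<close> over the values \<open>v\<close> of these cuts. Put \<open>L = ln n\<close>; then \<open>p ^ v = exp (- (2 + \<delta>) * L * (v / c))\<close>
  is the integral of \<open>(2 + \<delta>) * L * exp (- (2 + \<delta>) * L * t)\<close> over \<open>t \<ge> v / c\<close>. Exchanging sum and
  integral and inserting the bound \<open>exp (2 * L * t)\<close> on the number of cuts leaves the integral of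
  \<open>(2 + \<delta>) * L * exp (- \<delta> * L * t)\<close> over \<open>t \<ge> \<alpha>\<close>, which is the claimed bound. A disconnected graph
  has a failing cut, so part (1) is the case \<open>\<alpha> = 1\<close> of part (2).
\<close>

section \<open>Boundaries and sides of cuts\<close>

text \<open>Edge set and endpoint map are separate parameters, so that a contraction changes only
  \<open>f\<close> and the vertex set. Merged endpoints turn an edge into a loop, and loops lie in
  no boundary.\<close>

definition boundary :: "'e set \<Rightarrow> ('e \<Rightarrow> 'v set) \<Rightarrow> 'v set \<Rightarrow> 'e set" where
  "boundary E f A = {e \<in> E. f e \<inter> A \<noteq> {} \<and> \<not> f e \<subseteq> A}"

lemma boundary_image: "boundary E (\<lambda>e. h ` f e) A = boundary E f (h -` A)"
  by (auto simp: boundary_def)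

lemma boundary_cong_Int:
  assumes "\<And>e. e \<in> E \<Longrightarrow> f e \<subseteq> V" "A \<inter> V = B \<inter> V"
  shows "boundary E f A = boundary E f B"
  unfolding boundary_def using assms by blast

definition proper_subsets :: "'v set \<Rightarrow> 'v set set" where
  "proper_subsets V = {A. A \<subseteq> V \<and> A \<noteq> {} \<and> A \<noteq> V}"

lemma finite_proper_subsets: "finite V \<Longrightarrow> finite (proper_subsets V)"
  by (rule finite_subset[of _ "Pow V"]) (auto simp: proper_subsets_def)

text \<open>Each cut is counted twice in \<open>light_sets\<close>, once for each of its groups.\<close>

definition light_sets :: "'e set \<Rightarrow> ('e \<Rightarrow> 'v set) \<Rightarrow> 'v set \<Rightarrow> real \<Rightarrow> 'v set set" where
  "light_sets E f V t = {A \<in> proper_subsets V. real (card (boundary E f A)) \<le> t}"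

lemma finite_light_sets: "finite V \<Longrightarrow> finite (light_sets E f V t)"
  by (simp add: light_sets_def finite_proper_subsets)

section \<open>Counting light sets by contraction\<close>

text \<open>A singleton is a side of a cut, so every vertex is an end of at least \<open>c\<close>
  non-loop edges, and each such edge is counted at exactly two vertices.\<close>

lemma handshake:
  assumes "finite V" "finite E" "card V \<ge> 2"
    and sub: "\<And>e. e \<in> E \<Longrightarrow> f e \<subseteq> V" and card2: "\<And>e. e \<in> E \<Longrightarrow> card (f e) \<in> {1, 2}"
    and min: "\<And>A. A \<in> proper_subsets V \<Longrightarrow> c \<le> card (boundary E f A)"
  shows "card V * c \<le> 2 * card {e \<in> E. card (f e) = 2}"
proof -
  let ?E = "{e \<in> E. card (f e) = 2}"
  have eq: "boundary E f {v} = {e \<in> ?E. v \<in> f e}" for v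
  proof -
    have "(f e \<inter> {v} \<noteq> {} \<and> \<not> f e \<subseteq> {v}) \<longleftrightarrow> (card (f e) = 2 \<and> v \<in> f e)" if "e \<in> E" for e
    proof -
      consider "card (f e) = 1" | "card (f e) = 2" using card2 \<open>e \<in> E\<close> by blast
      then show ?thesis
        by cases (auto simp: card_1_singleton_iff card_2_iff)
    qed
    then show ?thesis by (auto simp: boundary_def)
  qed
  have "{v} \<in> proper_subsets V" if "v \<in> V" for v
    using that \<open>card V \<ge> 2\<close> by (auto simp: proper_subsets_def)
  then have "c \<le> card {e \<in> ?E. v \<in> f e}" if "v \<in> V" for v
    using min that unfolding eq[symmetric] by blast
  then have "card V * c \<le> (\<Sum>v\<in>V. card {e \<in> ?E. v \<in> f e})"
    using sum_bounded_below[of V c "\<lambda>v. card {e \<in> ?E. v \<in> f e}"] by simp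
  also have "\<dots> = (\<Sum>e\<in>?E. card {v \<in> V. v \<in> f e})"
    using sum_multicount_gen[of V ?E "\<lambda>v e. v \<in> f e" "\<lambda>e. card {v \<in> V. v \<in> f e}"] assms(1,2)
    by simp
  also have "\<dots> = (\<Sum>e\<in>?E. 2)"
  proof (rule sum.cong)
    fix e assume "e \<in> ?E"
    moreover from this have "{v \<in> V. v \<in> f e} = f e" using sub by auto
    ultimately show "card {v \<in> V. v \<in> f e} = 2" by simp
  qed simp
  finally show ?thesis by simp
qed

text \<open>Inductive step for the count of light sets, where averaging over contractions costs the
  factor \<open>n / (n - a)\<close>. Passing from \<open>n - 1 choose k\<close> to
  \<open>n choose k\<close> absorbs \<open>n / (n - k)\<close>; the remaining
  \<open>(n - k) / (n - a)\<close> is absorbed by the change of base of the power.\<close>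

lemma choose_powr_step:
  fixes a :: real
  assumes "k < n" "real k - 1 \<le> a" "a \<le> k"
  shows "real (n - 1 choose k) * real (n - k) powr (a - k) * n / (n - a)
    \<le> real (n choose k) * real (n - k + 1) powr (a - k)"
proof -
  define j where "j = real (n - k)"
  define \<theta> where "\<theta> = real k - a"
  have j: "j \<ge> 1" and nk: "real n = j + k" and na: "n - a = j + \<theta>"
    using assms by (auto simp: j_def \<theta>_def)
  have th: "0 \<le> \<theta>" "\<theta> \<le> 1" using assms by (auto simp: \<theta>_def)
  have "n * (n - 1 choose k) = (n - k) * (n choose k)"
    using binomial_absorb_comp[of n k] by simp
  then have abs: "real (n - 1 choose k) * n = real (n choose k) * j"
    unfolding j_def by (metis mult.commute of_nat_mult)
  \<comment> \<open>The step from \<open>n - 1\<close> to \<open>n\<close> is the weighted AM-GM inequality for \<open>j\<close> and \<open>j + 1\<close>.\<close>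
  have "j powr (1 - \<theta>) * (j + 1) powr \<theta> \<le> (1 - \<theta>) * j + \<theta> * (j + 1)"
    using j th by (intro Youngs_inequality_0) auto
  also have "\<dots> = j + \<theta>" by (simp add: algebra_simps)
  finally have "j powr (1 - \<theta>) \<le> (j + \<theta>) * (j + 1) powr (- \<theta>)"
    using j by (simp add: powr_minus field_simps)
  then have Y: "j * j powr (- \<theta>) / (j + \<theta>) \<le> (j + 1) powr (- \<theta>)"
    using j th powr_mult_base[of j "- \<theta>"] by (simp add: divide_le_eq mult.commute)
  have "real (n - 1 choose k) * j powr (- \<theta>) * n / (n - a)
      = real (n choose k) * (j * j powr (- \<theta>) / (j + \<theta>))"
    unfolding na using abs by (simp add: field_simps)
  also have "\<dots> \<le> real (n choose k) * (j + 1) powr (- \<theta>)"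
    using Y by (rule mult_left_mono) simp
  finally show ?thesis
    by (simp add: j_def \<theta>_def add.commute)
qed

text \<open>A set that does not separate \<open>x\<close> from \<open>y\<close> keeps its boundary
  when \<open>y\<close> is merged into \<open>x\<close>. Dropping \<open>y\<close> from it loses
  nothing, as \<open>x\<close> still tells whether \<open>y\<close> belonged to it.\<close>

lemma card_light_sets_contract_le:
  assumes "finite V" "x \<in> V" "y \<in> V" "x \<noteq> y"
  defines "h \<equiv> (\<lambda>z. if z = y then x else z)"
  shows "card {A \<in> light_sets E f V t. x \<in> A \<longleftrightarrow> y \<in> A}
    \<le> card (light_sets E (\<lambda>e. h ` f e) (V - {y}) t)"
proof (rule card_inj_on_le[where f = "\<lambda>A. A - {y}"])
  show "inj_on (\<lambda>A. A - {y}) {A \<in> light_sets E f V t. x \<in> A \<longleftrightarrow> y \<in> A}"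
    using \<open>x \<noteq> y\<close> by (auto simp: inj_on_def)
  show "finite (light_sets E (\<lambda>e. h ` f e) (V - {y}) t)"
    using assms by (simp add: finite_light_sets)
  have "A - {y} \<in> light_sets E (\<lambda>e. h ` f e) (V - {y}) t"
    if A: "A \<in> light_sets E f V t" "x \<in> A \<longleftrightarrow> y \<in> A" for A
  proof -
    have "h -` (A - {y}) = A"
      using A(2) \<open>x \<noteq> y\<close> by (auto simp: h_def split: if_splits)
    moreover have "A - {y} \<in> proper_subsets (V - {y})"
      using A assms(2-4) by (auto simp: light_sets_def proper_subsets_def)
    ultimately show ?thesis
      using A by (simp add: light_sets_def boundary_image)
  qed
  then show "(\<lambda>A. A - {y}) ` {A \<in> light_sets E f V t. x \<in> A \<longleftrightarrow> y \<in> A}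
    \<subseteq> light_sets E (\<lambda>e. h ` f e) (V - {y}) t" by auto
qed

text \<open>Contraction creates no new cuts: a side in the contracted graph pulls back to a side in
  the original one with the same boundary.\<close>

lemma card_boundary_contract_ge:
  assumes "x \<in> V" "y \<in> V" "x \<noteq> y"
    and sub: "\<And>e. e \<in> E \<Longrightarrow> f e \<subseteq> V"
    and min: "\<And>A. A \<in> proper_subsets V \<Longrightarrow> c \<le> card (boundary E f A)"
    and A: "A \<in> proper_subsets (V - {y})"
  shows "c \<le> card (boundary E (\<lambda>e. (\<lambda>z. if z = y then x else z) ` f e) A)"
proof -
  let ?B = "(\<lambda>z. if z = y then x else z) -` A \<inter> V"
  have "A \<subseteq> ?B" "y \<in> ?B \<longleftrightarrow> x \<in> A"
    using A assms(1-3) by (auto simp: proper_subsets_def)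
  \<comment> \<open>This rules out \<open>?B = V\<close>, which would make \<open>A\<close> all of
    \<open>V - {y}\<close>.\<close>
  moreover have "?B - {y} = A" using A by (auto simp: proper_subsets_def)
  ultimately have "?B \<in> proper_subsets V"
    using A by (auto simp: proper_subsets_def)
  moreover have "boundary E f ((\<lambda>z. if z = y then x else z) -` A) = boundary E f ?B"
    using sub by (intro boundary_cong_Int[of E f V]) auto
  ultimately show ?thesis
    unfolding boundary_image using min by simp
qed

text \<open>Double counting of pairs of a light set and a non-loop edge outside its boundary, the
  counting form of contracting a uniformly random edge. Each light set is in many pairs because its
  boundary is small; each edge \<open>{x, y}\<close> is in at most \<open>B\<close>, since the light
  sets paired with it do not separate \<open>x\<close> from \<open>y\<close>.\<close>

lemma light_sets_average:
  fixes a B :: real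
  assumes "finite V" "finite E" "card V \<ge> 2" "c > 0" "a < card V"
    and sub: "\<And>e. e \<in> E \<Longrightarrow> f e \<subseteq> V" and card2: "\<And>e. e \<in> E \<Longrightarrow> card (f e) \<in> {1, 2}"
    and min: "\<And>A. A \<in> proper_subsets V \<Longrightarrow> c \<le> card (boundary E f A)"
    and B: "\<And>x y. x \<in> V \<Longrightarrow> y \<in> V \<Longrightarrow> x \<noteq> y
      \<Longrightarrow> card {A \<in> light_sets E f V (a * c / 2). x \<in> A \<longleftrightarrow> y \<in> A} \<le> B"
    and "a \<ge> 0"
  shows "card (light_sets E f V (a * c / 2)) \<le> B * card V / (card V - a)"
proof -
  let ?E = "{e \<in> E. card (f e) = 2}" and ?S = "light_sets E f V (a * c / 2)"
  define m n where "m = card ?E" and "n = card V"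
  have fin: "finite ?E" "finite ?S" using assms by (auto simp: finite_light_sets)
  have hs: "real n * c \<le> 2 * m"
    using handshake[OF assms(1,2,3) sub card2 min] unfolding m_def n_def
    by (metis (no_types, lifting) of_nat_le_iff of_nat_mult of_nat_numeral)
  have n: "n > 0" "a < n" using assms by (auto simp: n_def)
  have "0 < real n * c" using n assms by simp
  then have m: "m > 0" using hs by linarith
  have le: "real m - a * c / 2 \<le> card {e \<in> ?E. e \<notin> boundary E f A}" if "A \<in> ?S" for A
  proof -
    have "boundary E f A \<subseteq> ?E"
    proof
      fix e assume e: "e \<in> boundary E f A"
      then have "e \<in> E" by (simp add: boundary_def)
      moreover have "card (f e) \<noteq> 1"
        using e by (auto simp: boundary_def card_1_singleton_iff)
      ultimately show "e \<in> ?E" using card2 by auto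
    qed
    moreover have "{e \<in> ?E. e \<notin> boundary E f A} = ?E - boundary E f A" by auto
    ultimately have "card {e \<in> ?E. e \<notin> boundary E f A} = m - card (boundary E f A)"
      using card_Diff_subset[of "boundary E f A" ?E] fin
      by (metis finite_subset m_def)
    moreover have "card (boundary E f A) \<le> a * c / 2" using that by (simp add: light_sets_def)
    ultimately show ?thesis by linarith
  qed
  have "card ?S * (m - a * c / 2) \<le> (\<Sum>A\<in>?S. real (card {e \<in> ?E. e \<notin> boundary E f A}))"
    using sum_bounded_below[of ?S, OF le] by simp
  also have "\<dots> = real (\<Sum>A\<in>?S. card {e \<in> ?E. e \<notin> boundary E f A})" by simp
  also have "(\<Sum>A\<in>?S. card {e \<in> ?E. e \<notin> boundary E f A}) = (\<Sum>e\<in>?E. card {A \<in> ?S. e \<notin> boundary E f A})"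
    using fin by (intro sum_multicount_gen) auto
  also have "real \<dots> = (\<Sum>e\<in>?E. real (card {A \<in> ?S. e \<notin> boundary E f A}))" by simp
  also have "\<dots> \<le> of_nat (card ?E) * B"
  proof (rule sum_bounded_above)
    fix e assume e: "e \<in> ?E"
    then obtain x y where xy: "f e = {x, y}" "x \<noteq> y" by (auto simp: card_2_iff)
    have "{A \<in> ?S. e \<notin> boundary E f A} = {A \<in> ?S. x \<in> A \<longleftrightarrow> y \<in> A}"
      using e xy by (auto simp: boundary_def)
    then show "real (card {A \<in> ?S. e \<notin> boundary E f A}) \<le> B"
      using B[of x y] xy e sub[of e] by auto
  qed
  finally have 1: "card ?S * (m - a * c / 2) \<le> m * B" by (simp add: m_def)
  \<comment> \<open>By the handshake bound, the fraction of edges avoiding a light boundary is at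
    least \<open>(n - a) / n\<close>.\<close>
  have "a * (real n * c) \<le> a * (2 * m)" using hs assms by (intro mult_left_mono) auto
  then have "m * (n - a) \<le> n * (m - a * c / 2)" by (simp add: algebra_simps)
  then have "card ?S * (m * (n - a)) \<le> card ?S * (n * (m - a * c / 2))"
    by (rule mult_left_mono) simp
  also have "\<dots> \<le> n * (m * B)" using mult_left_mono[OF 1, of n] by (simp add: algebra_simps)
  finally have "m * (card ?S * (n - a)) \<le> m * (B * n)" by (simp add: algebra_simps)
  then have "card ?S * (n - a) \<le> B * n" using m by simp
  then show ?thesis using n by (simp add: n_def field_simps)
qed

text \<open>
  The last factor makes the bound inductive for non-integral \<open>a\<close>. The bound \<open>n powr a\<close> itself is not:
  the step multiplies the count by \<open>n / (n - a)\<close>, which exceeds \<open>(n / (n - 1)) powr a\<close>.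
\<close>

lemma card_light_sets_le:
  fixes a :: real
  assumes "finite V" "finite E" "card V = n" "k \<le> n" "2 \<le> k" "c > 0" "real k - 1 \<le> a" "a \<le> k"
    and "\<And>e. e \<in> E \<Longrightarrow> f e \<subseteq> V" and "\<And>e. e \<in> E \<Longrightarrow> card (f e) \<in> {1, 2}"
    and "\<And>A. A \<in> proper_subsets V \<Longrightarrow> c \<le> card (boundary E f A)"
  shows "card (light_sets E f V (a * c / 2))
    \<le> 2 ^ k * (n choose k) * real (n - k + 1) powr (a - k)"
  using assms(4,1-3,5-)
proof (induction n arbitrary: V f rule: dec_induct)
  case base
  \<comment> \<open>For \<open>n = k\<close> the binomial coefficient and the last factor are 1, so
    counting all subsets suffices.\<close>
  have "card (light_sets E f V (a * c / 2)) \<le> card (Pow V)"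
    using base.prems(1) by (intro card_mono) (auto simp: light_sets_def proper_subsets_def)
  also have "\<dots> = 2 ^ k" using base.prems by (simp add: card_Pow)
  finally show ?case by (simp add: of_nat_le_iff[symmetric] del: of_nat_le_iff)
next
  case (step n)
  define B where "B = 2 ^ k * (n choose k) * real (n - k + 1) powr (a - k)"
  have "card {A \<in> light_sets E f V (a * c / 2). x \<in> A \<longleftrightarrow> y \<in> A} \<le> B"
    if xy: "x \<in> V" "y \<in> V" "x \<noteq> y" for x y
  proof -
    \<comment> \<open>Merging \<open>y\<close> into \<open>x\<close> leaves \<open>n\<close>
      vertices and the same \<open>c\<close>; all edges stay, those between \<open>x\<close> and
      \<open>y\<close> as loops.\<close>
    let ?f = "\<lambda>e. (\<lambda>z. if z = y then x else z) ` f e"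
    have "card (light_sets E ?f (V - {y}) (a * c / 2)) \<le> B"
      unfolding B_def
    proof (rule step.IH)
      show "card (V - {y}) = n" using step.prems xy by simp
      show "?f e \<subseteq> V - {y}" if "e \<in> E" for e
        using step.prems(8)[OF that] xy by auto
      show "card (?f e) \<in> {1, 2}" if "e \<in> E" for e
      proof -
        have fin: "finite (f e)" "f e \<noteq> {}"
          using step.prems(9)[OF that] by (auto intro: card_ge_0_finite)
        have "card (?f e) \<le> card (f e)" "card (?f e) > 0"
          using card_image_le[OF fin(1)] fin by (blast, simp only: card_gt_0_iff image_is_empty) simp
        then show ?thesis using step.prems(9)[OF that] by auto
      qed
      show "c \<le> card (boundary E ?f A)" if "A \<in> proper_subsets (V - {y})" for A
        using card_boundary_contract_ge[OF xy step.prems(8,10) that] .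
    qed (use step.prems in auto)
    moreover have "card {A \<in> light_sets E f V (a * c / 2). x \<in> A \<longleftrightarrow> y \<in> A}
        \<le> card (light_sets E ?f (V - {y}) (a * c / 2))"
      using card_light_sets_contract_le[OF step.prems(1) xy] .
    ultimately show ?thesis by linarith
  qed
  \<comment> \<open>Since \<open>a \<le> k \<le> n < Suc n\<close>, the denominator is
    positive.\<close>
  then have "card (light_sets E f V (a * c / 2)) \<le> B * card V / (card V - a)"
    using step.prems step.hyps by (intro light_sets_average) auto
  also have "\<dots> = 2 ^ k * (real (Suc n - 1 choose k) * real (Suc n - k) powr (a - k) * Suc n / (Suc n - a))"
    using step.prems step.hyps by (simp add: B_def Suc_diff_le)
  also have "\<dots> \<le> 2 ^ k * (real (Suc n choose k) * real (Suc n - k + 1) powr (a - k))"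
    using step.prems step.hyps by (intro mult_left_mono choose_powr_step) auto
  finally show ?case by (simp add: mult.assoc)
qed

section \<open>Bounding the count by a power of the number of vertices\<close>

text \<open>The ratio peaks at 2, for \<open>k = 1\<close> and \<open>k = 2\<close>. This 2 ends up
  as the leading constant for light sets and cancels against the two sides of each cut.\<close>

lemma two_power_le_2_fact: "2 ^ k \<le> 2 * (fact k :: nat)"
proof (induction k)
  case (Suc k)
  then show ?case
  proof (cases "k = 0")
    case False
    then have "2 * 2 ^ k \<le> Suc k * (2 * (fact k :: nat))" using Suc by (intro mult_mono) auto
    then show ?thesis by (simp add: algebra_simps)
  qed simp
qed simp

text \<open>The exponent \<open>a - k\<close> is not positive, so the base
  \<open>j = n - k + 1\<close> cannot simply be raised to \<open>n\<close>. Splitting the smallest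
  factor, \<open>j\<close> itself, off the falling factorial in the binomial coefficient lifts the
  exponent to \<open>a - (k - 1) \<ge> 0\<close>; the other \<open>k - 1\<close> factors are at most
  \<open>n\<close> each.\<close>

lemma two_power_choose_powr_le:
  fixes a :: real
  assumes "1 \<le> k" "k \<le> n" "real k - 1 \<le> a" "a \<le> k"
  shows "2 ^ k * (n choose k) * real (n - k + 1) powr (a - k) \<le> 2 * real n powr a"
proof -
  define j where "j = n - k + 1"
  have j: "1 \<le> j" "j \<le> n" using assms by (auto simp: j_def)
  obtain i where k: "k = Suc i" using assms by (cases k) auto
  have "Suc i * (n choose Suc i) = (n - i) * (n choose i)"
    using binomial_absorption[of i n] binomial_absorb_comp[of n i] by simp
  moreover have "n - i = j" using k assms by (simp add: j_def)
  ultimately have "Suc i * (n choose k) = j * (n choose i)" by (simp only: k)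
  then have "fact k * (n choose k) = j * ((n choose i) * fact i)"
    by (simp only: k fact_Suc of_nat_id mult_ac)
  also have "\<dots> \<le> j * n ^ i" using binomial_fact_pow by simp
  finally have "2 * fact k * (n choose k) \<le> 2 * (j * n ^ i)" by (simp add: algebra_simps)
  moreover have "2 ^ k * (n choose k) \<le> 2 * fact k * (n choose k)"
    using two_power_le_2_fact[of k] by simp
  ultimately have "2 ^ k * (n choose k) \<le> 2 * (j * n ^ i)" by linarith
  then have "real (2 ^ k * (n choose k)) \<le> real (2 * (j * n ^ i))" by (simp only: of_nat_le_iff)
  then have "2 ^ k * (n choose k) * real j powr (a - k) \<le> 2 * (j * n ^ i) * real j powr (a - k)"
    by (intro mult_right_mono) auto
  also have "\<dots> = 2 * n powr i * (real j powr 1 * real j powr (a - k))"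
    using j by (simp add: powr_realpow)
  also have "\<dots> = 2 * n powr i * real j powr (a - i)"
    by (simp only: powr_add[symmetric]) (simp add: k)
  also have "\<dots> \<le> 2 * n powr i * real n powr (a - i)"
    using j assms k by (intro mult_left_mono powr_mono2) auto
  also have "\<dots> = 2 * real n powr a"
    by (simp add: powr_add[symmetric])
  finally show ?thesis by (simp add: j_def)
qed

lemma card_light_sets_le_powr:
  fixes a :: real
  assumes "finite V" "finite E" "card V = n" "2 \<le> n" "2 \<le> a" "c > 0"
    and "\<And>e. e \<in> E \<Longrightarrow> f e \<subseteq> V" and "\<And>e. e \<in> E \<Longrightarrow> card (f e) \<in> {1, 2}"
    and "\<And>A. A \<in> proper_subsets V \<Longrightarrow> c \<le> card (boundary E f A)"
  shows "card (light_sets E f V (a * c / 2)) \<le> 2 * real n powr a"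
proof (cases "a \<le> n")
  case True
  define k where "k = nat \<lceil>a\<rceil>"
  have k: "k \<le> n" "2 \<le> k" "real k - 1 \<le> a" "a \<le> k"
    using True \<open>2 \<le> a\<close> unfolding k_def by linarith+
  have "card (light_sets E f V (a * c / 2)) \<le> 2 ^ k * (n choose k) * real (n - k + 1) powr (a - k)"
    using assms k by (intro card_light_sets_le) auto
  also have "\<dots> \<le> 2 * real n powr a"
    using k by (intro two_power_choose_powr_le) auto
  finally show ?thesis .
next
  case False
  \<comment> \<open>For \<open>a > n\<close> the number of all subsets is already below the bound,
    as \<open>2 \<le> n\<close>.\<close>
  have "card (light_sets E f V (a * c / 2)) \<le> card (Pow V)"
    using assms by (intro card_mono) (auto simp: light_sets_def proper_subsets_def)
  also have "\<dots> = 2 ^ n" using assms by (simp add: card_Pow)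
  also have "\<dots> \<le> n ^ n" using assms by (intro power_mono) auto
  finally have "real (card (light_sets E f V (a * c / 2))) \<le> real (n ^ n)"
    by (simp only: of_nat_le_iff)
  also have "\<dots> = real n powr n" using assms by (simp add: powr_realpow)
  also have "\<dots> \<le> real n powr a" using assms False by (intro powr_mono) auto
  also have "\<dots> \<le> 2 * real n powr a" by simp
  finally show ?thesis .
qed

section \<open>Exponential sums from a counting bound\<close>

lemma sum_exp_le_of_card_le:
  fixes w :: "'a \<Rightarrow> real"
  assumes "finite X" "b < l" "0 < l" "\<And>x. x \<in> X \<Longrightarrow> s \<le> w x"
    and count: "\<And>t. s \<le> t \<Longrightarrow> card {x \<in> X. w x \<le> t} \<le> exp (b * t)"
  shows "(\<Sum>x\<in>X. exp (- l * w x)) \<le> l / (l - b) * exp (- (l - b) * s)"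
proof -
  \<comment> \<open>Extension by zero puts all integrals on the common domain \<open>{s..}\<close>,
    which contains \<open>{w x..}\<close> because \<open>s \<le> w x\<close>.\<close>
  have "((\<lambda>t. if t \<in> {w x..} then exp (- l * t) else 0) has_integral exp (- l * w x) / l) {s..}"
    if "x \<in> X" for x
    using that assms has_integral_exp_minus_to_infinity[of l "w x"]
    by (subst has_integral_restrict) auto
  then have "((\<lambda>t. \<Sum>x\<in>X. if t \<in> {w x..} then exp (- l * t) else 0) has_integral
      (\<Sum>x\<in>X. exp (- l * w x) / l)) {s..}"
    by (intro has_integral_sum assms)
  moreover have "((\<lambda>t. exp (- (l - b) * t)) has_integral exp (- (l - b) * s) / (l - b)) {s..}"
    using assms by (intro has_integral_exp_minus_to_infinity) auto
  moreover have "(\<Sum>x\<in>X. if t \<in> {w x..} then exp (- l * t) else 0) \<le> exp (- (l - b) * t)"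
    if "t \<in> {s..}" for t
  proof -
    have "(\<Sum>x\<in>X. if t \<in> {w x..} then exp (- l * t) else 0) = card {x \<in> X. w x \<le> t} * exp (- l * t)"
      using \<open>finite X\<close> by (simp add: sum.If_cases Int_def)
    also have "\<dots> \<le> exp (b * t) * exp (- l * t)"
      using count that by (intro mult_right_mono) auto
    finally show ?thesis by (simp add: exp_add[symmetric] algebra_simps)
  qed
  ultimately have "(\<Sum>x\<in>X. exp (- l * w x) / l) \<le> exp (- (l - b) * s) / (l - b)"
    by (rule has_integral_le)
  then show ?thesis
    using \<open>0 < l\<close> by (simp add: sum_divide_distrib[symmetric] field_simps)
qed


section \<open>Cuts of the graph and disconnection\<close>

context fin_multigraph
begin

lemma finite_cuts: "finite (cuts G)"
  by (rule finite_subset[of _ "Pow (Pow (verts G))"])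
    (auto simp: cuts_def partition_on_def finite_verts)

lemma cut_blocks:
  assumes "C \<in> cuts G" "A \<in> C"
  shows "C = {A, verts G - A}" "A \<in> proper_subsets (verts G)"
proof -
  have C: "partition_on (verts G) C" "card C = 2" using assms by (auto simp: cuts_def)
  then obtain B where B: "C = {A, B}" "A \<noteq> B"
    using \<open>A \<in> C\<close> by (metis card_2_iff doubleton_eq_iff insertE singletonD)
  then have "A \<union> B = verts G" "A \<inter> B = {}" "A \<noteq> {}" "B \<noteq> {}"
    using C(1) by (auto simp: partition_on_def disjoint_def)
  then show "C = {A, verts G - A}" "A \<in> proper_subsets (verts G)"
    using B by (auto simp: proper_subsets_def)
qed

lemma cut_of_proper_subset:
  assumes "A \<in> proper_subsets (verts G)"
  shows "{A, verts G - A} \<in> cuts G"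
proof -
  have "A \<noteq> verts G - A" "A \<union> (verts G - A) = verts G" "A \<noteq> {}" "verts G - A \<noteq> {}"
    using assms unfolding proper_subsets_def by blast+
  then show ?thesis
    unfolding cuts_def partition_on_def disjoint_def by simp blast
qed

lemma cut_value_eq_card_boundary:
  "cut_value G {A, verts G - A} = card (boundary (edges G) (ends G) A)"
proof -
  have "cut_edges G {A, verts G - A} = boundary (edges G) (ends G) A"
    using ends_in_verts by (auto simp: cut_edges_def boundary_def)
  then show ?thesis by (simp add: cut_value_def)
qed

lemma min_cut_value_le: "C \<in> cuts G \<Longrightarrow> min_cut_value G \<le> cut_value G C"
  unfolding min_cut_value_def using finite_cuts by (intro Min_le) auto

text \<open>Pair each light cut with each of its two groups. A group determines its cut, the other
  group being the complement, so there are at most as many pairs as light sets for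
  \<open>a = 2 * t\<close>.\<close>

lemma card_light_cuts_le:
  fixes t :: real
  assumes "card (verts G) = n" "2 \<le> n" "min_cut_value G > 0" "1 \<le> t"
  shows "card {C \<in> cuts G. cut_value G C \<le> t * min_cut_value G} \<le> real n powr (2 * t)"
proof -
  define L where "L = light_sets (edges G) (ends G) (verts G) (2 * t * min_cut_value G / 2)"
  define X where "X = {C \<in> cuts G. cut_value G C \<le> t * min_cut_value G}"
  have fin: "finite X" "finite L"
    by (auto simp: X_def L_def finite_cuts finite_light_sets finite_verts)
  have "card (SIGMA C:X. C) \<le> card L"
  proof (rule card_inj_on_le[where f = snd])
    show "inj_on snd (SIGMA C:X. C)"
    proof (rule inj_onI, clarsimp)
      fix C D A assume "C \<in> X" "A \<in> C" "D \<in> X" "A \<in> D"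
      then show "C = D"
        using cut_blocks(1)[of C A] cut_blocks(1)[of D A] unfolding X_def by blast
    qed
    show "snd ` (SIGMA C:X. C) \<subseteq> L"
    proof clarsimp
      fix C A assume "C \<in> X" "A \<in> C"
      then have "A \<in> proper_subsets (verts G)" "C = {A, verts G - A}"
        and "cut_value G C \<le> t * min_cut_value G"
        using cut_blocks[of C A] unfolding X_def by blast+
      then show "A \<in> L"
        by (simp add: L_def light_sets_def cut_value_eq_card_boundary)
    qed
  qed (fact fin)
  moreover have "card (SIGMA C:X. C) = 2 * card X"
  proof -
    have "card C = 2" if "C \<in> X" for C
      using that by (simp add: X_def cuts_def)
    moreover from this have "finite C" if "C \<in> X" for C
      using that by (intro card_ge_0_finite) simp
    ultimately show ?thesis using fin by (subst card_SigmaI) auto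
  qed
  moreover have "card L \<le> 2 * real n powr (2 * t)"
    unfolding L_def using assms
  proof (intro card_light_sets_le_powr)
    show "min_cut_value G \<le> card (boundary (edges G) (ends G) A)"
      if "A \<in> proper_subsets (verts G)" for A
      using min_cut_value_le[OF cut_of_proper_subset[OF that]]
      by (simp add: cut_value_eq_card_boundary)
  qed (use finite_verts finite_edges ends_in_verts card_ends in auto)
  ultimately show ?thesis by (simp add: X_def)
qed

text \<open>The vertices reachable from some \<open>u\<close> form one side of the cut: a surviving
  edge across it would make a further vertex reachable.\<close>

lemma failing_cut_if_disconnected:
  assumes "\<not> graph_connected (delete_edges G D)"
  shows "\<exists>C\<in>cuts G. cut_fails G D C"
proof -
  let ?R = "adjacency (delete_edges G D)"
  obtain u v where uv: "u \<in> verts G" "v \<in> verts G" "(u, v) \<notin> ?R\<^sup>*"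
    using assms by (auto simp: graph_connected_def delete_edges_def)
  define A where "A = {w \<in> verts G. (u, w) \<in> ?R\<^sup>*}"
  have "A \<in> proper_subsets (verts G)"
    using uv by (auto simp: A_def proper_subsets_def)
  moreover have "cut_edges G {A, verts G - A} \<subseteq> D"
  proof
    fix e assume e: "e \<in> cut_edges G {A, verts G - A}"
    then obtain x y where xy: "x \<in> ends G e" "x \<in> A" "y \<in> ends G e" "y \<in> verts G - A"
      and eG: "e \<in> edges G" by (auto simp: cut_edges_def)
    then have "x \<noteq> y" by auto
    then have "ends G e = {x, y}"
      using xy card_ends[OF eG] by (auto simp: card_1_singleton_iff card_2_iff)
    then have "(x, y) \<in> ?R" if "e \<notin> D"
      using that eG by (auto simp: adjacency_def delete_edges_def)
    moreover have "(u, x) \<in> ?R\<^sup>*" "(u, y) \<notin> ?R\<^sup>*" using xy by (auto simp: A_def)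
    ultimately show "e \<in> D" by (meson rtrancl.rtrancl_into_rtrancl)
  qed
  ultimately show ?thesis
    using cut_of_proper_subset by (auto simp: cut_fails_def)
qed

end

section \<open>Failure probabilities\<close>

text \<open>The event is the intersection of the failure events of the cut's edges, so independence
  gives a product. Positive value makes this a nonempty intersection, as \<open>indep_events\<close>
  demands, and keeps it inside \<open>space M\<close>.\<close>

lemma (in prob_space) cut_fails_event:
  assumes "fin_multigraph G" "indep_events F (edges G)"
    and "\<And>e. e \<in> edges G \<Longrightarrow> prob (F e) = p"
    and "cut_value G C > 0"
  shows "{\<omega> \<in> space M. cut_fails G (failed_edges G F \<omega>) C} \<in> events"
    and "prob {\<omega> \<in> space M. cut_fails G (failed_edges G F \<omega>) C} = p ^ cut_value G C"
proof -
  let ?K = "cut_edges G C"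
  have K: "?K \<subseteq> edges G" "?K \<noteq> {}" "finite ?K"
    using assms(4) card_gt_0_iff[of ?K] by (auto simp: cut_edges_def cut_value_def)
  have ev: "F ` edges G \<subseteq> events"
    and pr: "prob (\<Inter>e\<in>?K. F e) = (\<Prod>e\<in>?K. prob (F e))"
    using assms(2) K unfolding indep_events_def by auto
  have eq: "{\<omega> \<in> space M. cut_fails G (failed_edges G F \<omega>) C} = (\<Inter>e\<in>?K. F e)"
  proof -
    have "cut_fails G (failed_edges G F \<omega>) C \<longleftrightarrow> (\<forall>e\<in>?K. \<omega> \<in> F e)" for \<omega>
      using K(1) unfolding cut_fails_def failed_edges_def by blast
    moreover have "(\<Inter>e\<in>?K. F e) \<subseteq> space M"
      using K(1,2) ev sets.sets_into_space by blast
    ultimately show ?thesis by blast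
  qed
  show "{\<omega> \<in> space M. cut_fails G (failed_edges G F \<omega>) C} \<in> events"
    unfolding eq using K ev by (intro sets.finite_INT) auto
  have "(\<Prod>e\<in>?K. prob (F e)) = (\<Prod>e\<in>?K. p)"
    using K assms(3) by (intro prod.cong) auto
  then show "prob {\<omega> \<in> space M. cut_fails G (failed_edges G F \<omega>) C} = p ^ cut_value G C"
    unfolding eq pr by (simp add: cut_value_def)
qed

theorem theorem2p9:
  fixes G :: "('v, 'e) multigraph"
    and M :: "'w measure"
    and F :: "'e \<Rightarrow> 'w set"
    and n c :: nat
    and p \<delta> :: real
  assumes "fin_multigraph G"
    and "n = card (verts G)"
    and "n \<ge> 2"
    and "c = min_cut_value G"
    and "prob_space M"
    and "prob_space.indep_events M F (edges G)"
    and "\<And>e. e \<in> edges G \<Longrightarrow> measure M (F e) = p"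
    and "0 \<le> p" and "p \<le> 1"
    and "\<delta> > 0"
    and "p ^ c = real n powr (- (2 + \<delta>))"
  shows "measure M {\<omega> \<in> space M. \<not> graph_connected (delete_edges G (failed_edges G F \<omega>))}
           \<le> real n powr (- \<delta>) * (1 + 2 / \<delta>)
       \<and> (\<forall>\<alpha>::real. \<alpha> \<ge> 1 \<longrightarrow>
            measure M {\<omega> \<in> space M. \<exists>C \<in> cuts G. real (cut_value G C) \<ge> \<alpha> * real c
                                        \<and> cut_fails G (failed_edges G F \<omega>) C}
              \<le> real n powr (- (\<alpha> * \<delta>)) * (1 + 2 / \<delta>))"
proof -
  interpret fin_multigraph G by fact
  interpret prob_space M by fact
  define L where "L = ln (real n)"
  have L: "L > 0" using \<open>n \<ge> 2\<close> by (simp add: L_def)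
  have powr_n: "real n powr x = exp (x * L)" for x
    using \<open>n \<ge> 2\<close> by (simp add: powr_def L_def)
  have pc: "p ^ c = exp (- ((2 + \<delta>) * L))" using assms(11) by (simp only: powr_n minus_mult_left)
  \<comment> \<open>The relation between \<open>p\<close> and \<open>n\<close> forces
    \<open>c > 0\<close>, since \<open>c = 0\<close> would give \<open>p ^ c = 1\<close>.\<close>
  have "(2 + \<delta>) * L > 0" using L \<open>\<delta> > 0\<close> by simp
  then have "p ^ c < 1" unfolding pc by simp
  then have c: "c > 0" by (cases c) auto
  have p: "p > 0" using pc c \<open>0 \<le> p\<close> by (cases "p = 0") (auto simp: power_0_left)
  have p_power: "p ^ v = exp (- ((2 + \<delta>) * L) * (v / c))" for v :: nat
  proof -
    have "c * ln p = - ((2 + \<delta>) * L)"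
      using arg_cong[OF pc, of ln] p by (simp add: ln_realpow)
    then have "- ((2 + \<delta>) * L) * (v / c) = (c * ln p) * (v / c)" by (simp only:)
    also have "\<dots> = v * ln p" using c by simp
    finally have "exp (- ((2 + \<delta>) * L) * (v / c)) = exp (ln p) ^ v"
      by (simp only: exp_of_nat_mult)
    then show ?thesis using p by simp
  qed
  define bad where
    "bad \<alpha> = {\<omega> \<in> space M. \<exists>C\<in>cuts G. real (cut_value G C) \<ge> \<alpha> * real c
      \<and> cut_fails G (failed_edges G F \<omega>) C}" for \<alpha>
  define X where "X \<alpha> = {C \<in> cuts G. real (cut_value G C) \<ge> \<alpha> * real c}" for \<alpha>
  define ev where "ev C = {\<omega> \<in> space M. cut_fails G (failed_edges G F \<omega>) C}" for C
  have finX: "finite (X \<alpha>)" for \<alpha> by (simp add: X_def finite_cuts)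
  have bad_eq: "bad \<alpha> = (\<Union>C\<in>X \<alpha>. ev C)" for \<alpha> by (auto simp: bad_def X_def ev_def)
  have value_pos: "cut_value G C > 0" if "C \<in> cuts G" for C
    using min_cut_value_le[OF that] c \<open>c = min_cut_value G\<close> by simp
  have ev: "ev C \<in> events" "prob (ev C) = p ^ cut_value G C" if "C \<in> X \<alpha>" for C \<alpha>
    using cut_fails_event[OF assms(1,6,7) value_pos[of C]] that by (auto simp: X_def ev_def)
  have bad_events: "bad \<alpha> \<in> events" for \<alpha>
    unfolding bad_eq using finX ev(1) by (intro sets.finite_UN) auto
  have main: "prob (bad \<alpha>) \<le> real n powr (- (\<alpha> * \<delta>)) * (1 + 2 / \<delta>)" if "\<alpha> \<ge> 1" for \<alpha>
  proof -
    have "prob (bad \<alpha>) \<le> (\<Sum>C\<in>X \<alpha>. prob (ev C))"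
      unfolding bad_eq using finX ev(1) by (intro finite_measure_subadditive_finite) auto
    also have "\<dots> = (\<Sum>C\<in>X \<alpha>. exp (- ((2 + \<delta>) * L) * (cut_value G C / c)))"
      using ev(2) p_power by (intro sum.cong) auto
    \<comment> \<open>The weights are the values in units of \<open>c\<close>, with decay rate
      \<open>l = (2 + \<delta>) * L\<close> and growth rate \<open>b = 2 * L\<close> of the count.
      Then \<open>l - b = \<delta> * L\<close> and
      \<open>l / (l - b) = 1 + 2 / \<delta>\<close>.\<close>
    also have "\<dots> \<le> (2 + \<delta>) * L / ((2 + \<delta>) * L - 2 * L) * exp (- ((2 + \<delta>) * L - 2 * L) * \<alpha>)"
    proof (rule sum_exp_le_of_card_le)
      show "finite (X \<alpha>)" by (fact finX)
      show "2 * L < (2 + \<delta>) * L" "0 < (2 + \<delta>) * L" using L \<open>\<delta> > 0\<close> by auto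
      show "\<alpha> \<le> cut_value G C / c" if "C \<in> X \<alpha>" for C
        using that c by (simp add: X_def field_simps)
      fix t assume "\<alpha> \<le> t"
      have "card {C \<in> X \<alpha>. cut_value G C / c \<le> t} \<le> card {C \<in> cuts G. cut_value G C \<le> t * c}"
        using c by (intro card_mono) (auto simp: finite_cuts X_def field_simps)
      also have "\<dots> \<le> real n powr (2 * t)"
        using card_light_cuts_le[of n t] assms(2-4) c \<open>\<alpha> \<le> t\<close> \<open>\<alpha> \<ge> 1\<close> by simp
      finally show "card {C \<in> X \<alpha>. cut_value G C / c \<le> t} \<le> exp (2 * L * t)"
        by (simp add: powr_n algebra_simps)
    qed
    also have "\<dots> = real n powr (- (\<alpha> * \<delta>)) * (1 + 2 / \<delta>)"
      using L \<open>\<delta> > 0\<close> by (simp add: powr_n field_simps)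
    finally show ?thesis .
  qed
  \<comment> \<open>Every cut has value at least \<open>c\<close>, so \<open>bad 1\<close> is the
    event that any cut fails.\<close>
  have "{\<omega> \<in> space M. \<not> graph_connected (delete_edges G (failed_edges G F \<omega>))} \<subseteq> bad 1"
    using failing_cut_if_disconnected min_cut_value_le assms(4) by (fastforce simp: bad_def)
  then have "prob {\<omega> \<in> space M. \<not> graph_connected (delete_edges G (failed_edges G F \<omega>))} \<le> prob (bad 1)"
    using bad_events by (rule finite_measure_mono)
  with main[of 1] main show ?thesis by (simp add: bad_def)
qed

end
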